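(* Let $a_1,\dots,a_n$ be real numbers, not all zero, let $X=\{(x_1,x_2,\dots,x_n)\in\mathbb{R}^n: a_1x_1+a_2x_2+\dots+a_nx_n=0\}$ be the corresponding $(n-1)$-dimensional subspace of the space $\ell_\infty^n$, and let $1\leq k\leq n$ be an integer such that there exists a disjoint partition $\{1,2,\dots,n\}=A\cup B$ where $|A|=k$ and $\sum_{i\in A}|a_i|\geq\sum_{i\in B}|a_i|$. Then $e(X)\geq 2^{n-k}$.
   Context: For a real finite-dimensional normed space $X$ with norm $\|\cdot\|$, a set $S\subset X$ is called equilateral if there is $p>0$ such that $\|x-y\|=p$ for all $x,y\in S$, $x\neq y$. The equilateral dimension $e(X)$ is the maximal cardinality of an equilateral set in $X$. $\ell_\infty^n$ is $\mathbb{R}^n$ with the norm $\|x\|_\infty=\max_i|x_i|$; subspaces carry the restricted norm. The set $B$ may be empty (empty sums are $0$). *)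

theory Defs
  imports "HOL-Analysis.Analysis" "HOL-Library.Extended_Nat"
begin

text \<open>
  A normed space is given by a carrier \<open>X\<close> (a linear subspace of a real vector space) together
  with a norm \<open>N\<close> as an explicit function. This allows norms other than the type class
  norm, which is the Euclidean one on \<open>real ^ 'n\<close>.
\<close>

definition equilateral :: "('a::real_vector \<Rightarrow> real) \<Rightarrow> 'a set \<Rightarrow> bool" where
  "equilateral N S \<longleftrightarrow> (\<exists>p>0. \<forall>x\<in>S. \<forall>y\<in>S. x \<noteq> y \<longrightarrow> N (x - y) = p)"

text \<open>
  The supremum is taken in \<open>enat\<close>, so that it is meaningful without a prior bound on
  equilateral sets; if it is finite, it is a maximum. Subsets of equilateral sets are
  equilateral, so restricting to finite \<open>S\<close> (\<open>card\<close> is 0 on infinite sets) loses nothing: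
  an infinite equilateral set makes the value \<open>\<infinity>\<close>.
\<close>

definition equilateral_dim :: "('a::real_vector \<Rightarrow> real) \<Rightarrow> 'a set \<Rightarrow> enat" where
  "equilateral_dim N X = (SUP S \<in> {S. S \<subseteq> X \<and> finite S \<and> equilateral N S}. enat (card S))"

lemma equilateral_dim_attained:
  assumes "equilateral_dim N X = enat m"
  shows "\<exists>S. S \<subseteq> X \<and> finite S \<and> equilateral N S \<and> card S = m"
proof -
  let ?C = "(\<lambda>S. enat (card S)) ` {S. S \<subseteq> X \<and> finite S \<and> equilateral N S}"
  have "{} \<in> {S. S \<subseteq> X \<and> finite S \<and> equilateral N S}"
    by (auto simp: equilateral_def intro: exI[of _ 1])
  then have ne: "?C \<noteq> {}" by blast
  have sup: "Sup ?C = enat m" using assms by (simp add: equilateral_dim_def)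
  then have "finite ?C" using ne by (auto simp: Sup_enat_def split: if_splits)
  then have "Sup ?C \<in> ?C"
    using ne by (simp add: Sup_enat_def del: image_is_empty)
  then show ?thesis using sup by auto
qed

text \<open>The norm of \<open>\<ell>\<^sub>\<infinity>\<^sup>n\<close> is the library's \<open>infnorm\<close> on \<open>real ^ 'n\<close> with \<open>n = CARD('n)\<close>.\<close>

lemma infnorm_vec_Max: "infnorm (x :: real ^ 'n) = Max (range (\<lambda>i. \<bar>x $ i\<bar>))"
proof -
  have "infnorm x = Sup (range (\<lambda>i. \<bar>x $ i\<bar>))"
    by (simp add: infnorm_cart full_SetCompr_eq)
  then show ?thesis by (simp add: cSup_eq_Max)
qed

definition hyperplane0 :: "real ^ 'n \<Rightarrow> (real ^ 'n) set" where
  "hyperplane0 a = {x. (\<Sum>i\<in>UNIV. a $ i * x $ i) = 0}"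

lemma subspace_hyperplane0: "subspace (hyperplane0 a)"
  using subspace_hyperplane[of a] by (simp add: hyperplane0_def inner_vec_def)

lemma dim_hyperplane0: "a \<noteq> 0 \<Longrightarrow> dim (hyperplane0 (a :: real ^ 'n)) = CARD('n) - 1"
  using dim_hyperplane[of a] by (simp add: hyperplane0_def inner_vec_def)

end

theory Submission
  imports Defs
begin

text \<open>
  Every choice of signs \<open>\<plusminus>1\<close> on the coordinates in \<open>B\<close> extends to a point of the hyperplane
  with all coordinates in \<open>[-1, 1]\<close>: the sum over \<open>B\<close> is compensated on \<open>A\<close> by
  the coordinates \<open>- c sgn a\<^sub>i\<close> for a common \<open>c\<close>, and \<open>\<bar>c\<bar> \<le> 1\<close> because \<open>A\<close> carries at
  least half of the \<open>\<ell>\<^sub>1\<close> mass of \<open>a\<close>. Two such points with different signs are at distance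
  exactly 2.
\<close>

lemma infnorm_eqI:
  fixes x :: "real ^ 'n"
  assumes "\<And>i. \<bar>x $ i\<bar> \<le> r" and "\<bar>x $ j\<bar> = r"
  shows "infnorm x = r"
  unfolding infnorm_vec_Max
proof (rule Max_eqI)
  show "r \<in> range (\<lambda>i. \<bar>x $ i\<bar>)" using assms(2) by blast
qed (use assms(1) in auto)

lemma card_le_equilateral_dim:
  assumes "S \<subseteq> X" "finite S" "equilateral N S"
  shows "enat (card S) \<le> equilateral_dim N X"
  unfolding equilateral_dim_def using assms by (intro SUP_upper) auto

lemma hyperplane0_sign_extension:
  fixes a :: "real ^ 'n" and s :: "'n \<Rightarrow> real"
  assumes "a \<noteq> 0" and part: "A \<union> B = UNIV" "A \<inter> B = {}"
    and le: "(\<Sum>i\<in>B. \<bar>a $ i\<bar>) \<le> (\<Sum>i\<in>A. \<bar>a $ i\<bar>)"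
    and s: "\<And>i. \<bar>s i\<bar> \<le> 1"
  shows "\<exists>x\<in>hyperplane0 a. (\<forall>i. \<bar>x $ i\<bar> \<le> 1) \<and> (\<forall>i\<in>B. x $ i = s i)"
proof -
  define m where "m = (\<Sum>i\<in>A. \<bar>a $ i\<bar>)"
  \<comment> \<open>With coordinates \<open>- c * sgn (a $ i)\<close> on \<open>A\<close>, each term
    \<open>a $ i * x $ i\<close> equals \<open>- c * \<bar>a $ i\<bar>\<close>, so \<open>A\<close>
    contributes \<open>- c * m\<close>. Cancelling the sum over \<open>B\<close> forces this value
    of \<open>c\<close>.\<close>
  define c where "c = (\<Sum>i\<in>B. a $ i * s i) / m"
  define x :: "real ^ 'n" where "x = (\<chi> i. if i \<in> B then s i else - c * sgn (a $ i))"
  \<comment> \<open>If \<open>A\<close> carried no mass, then by \<open>le\<close> neither would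
    \<open>B\<close>, and \<open>a\<close> would vanish. So the division by \<open>m\<close> is
    genuine.\<close>
  have "m \<noteq> 0"
  proof
    assume "m = 0"
    then have A0: "\<forall>i\<in>A. a $ i = 0"
      by (simp add: m_def sum_nonneg_eq_0_iff)
    have "(\<Sum>i\<in>B. \<bar>a $ i\<bar>) = 0"
      using le \<open>m = 0\<close> by (simp add: m_def antisym sum_nonneg)
    then have "\<forall>i\<in>B. a $ i = 0"
      by (simp add: sum_nonneg_eq_0_iff)
    with A0 part(1) have "a = 0" by (auto simp: vec_eq_iff)
    with \<open>a \<noteq> 0\<close> show False by simp
  qed
  moreover have "0 \<le> m" by (simp add: m_def sum_nonneg)
  ultimately have "0 < m" by simp
  have "\<bar>\<Sum>i\<in>B. a $ i * s i\<bar> \<le> (\<Sum>i\<in>B. \<bar>a $ i * s i\<bar>)" by (rule sum_abs)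
  also have "\<dots> \<le> (\<Sum>i\<in>B. \<bar>a $ i\<bar>)"
    by (intro sum_mono) (simp add: abs_mult mult_left_le s)
  also have "\<dots> \<le> m" using le by (simp add: m_def)
  finally have c: "\<bar>c\<bar> \<le> 1" using \<open>0 < m\<close> by (simp add: c_def)
  have "(\<Sum>i\<in>UNIV. a $ i * x $ i) = (\<Sum>i\<in>A. a $ i * x $ i) + (\<Sum>i\<in>B. a $ i * x $ i)"
    using part by (metis finite sum.union_disjoint)
  also have "(\<Sum>i\<in>A. a $ i * x $ i) = (\<Sum>i\<in>A. - c * \<bar>a $ i\<bar>)"
    using part(2) by (intro sum.cong) (auto simp: x_def abs_sgn)
  also have "\<dots> = - c * m" by (simp add: m_def sum_distrib_left sum_negf)
  also have "(\<Sum>i\<in>B. a $ i * x $ i) = c * m"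
    using \<open>0 < m\<close> by (simp add: x_def c_def)
  finally have "x \<in> hyperplane0 a" by (simp add: hyperplane0_def)
  moreover have "\<bar>x $ i\<bar> \<le> 1" for i
    using s c by (simp add: x_def abs_mult abs_sgn_eq)
  moreover have "\<forall>i\<in>B. x $ i = s i" by (simp add: x_def)
  ultimately show ?thesis by blast
qed

theorem theorem1p9:
  fixes a :: "real ^ 'n" and k :: nat
  assumes "\<exists>i. a $ i \<noteq> 0"
    and "1 \<le> k" and "k \<le> CARD('n)"
    and "\<exists>A B :: 'n set. A \<union> B = UNIV \<and> A \<inter> B = {} \<and> card A = k \<and>
           (\<Sum>i\<in>A. \<bar>a $ i\<bar>) \<ge> (\<Sum>i\<in>B. \<bar>a $ i\<bar>)"
  shows "equilateral_dim infnorm (hyperplane0 a) \<ge> 2 ^ (CARD('n) - k)"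
proof -
  obtain A B :: "'n set" where part: "A \<union> B = UNIV" "A \<inter> B = {}" and "card A = k"
    and le: "(\<Sum>i\<in>B. \<bar>a $ i\<bar>) \<le> (\<Sum>i\<in>A. \<bar>a $ i\<bar>)"
    using assms(4) by blast
  have "CARD('n) = card A + card B"
    using part by (metis card_Un_disjoint finite)
  then have card_B: "card B = CARD('n) - k" using \<open>card A = k\<close> by simp
  have "a \<noteq> 0" using assms(1) by auto
  \<comment> \<open>A subset \<open>T\<close> of \<open>B\<close> encodes a sign pattern: +1 on
    \<open>T\<close> and -1 on the rest of \<open>B\<close>. The values of \<open>s T\<close>
    outside \<open>B\<close> do not affect \<open>f T\<close>'s prescribed coordinates.\<close>
  define s :: "'n set \<Rightarrow> 'n \<Rightarrow> real" where "s T i = (if i \<in> T then 1 else -1)" for T i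
  have "\<exists>x\<in>hyperplane0 a. (\<forall>i. \<bar>x $ i\<bar> \<le> 1) \<and> (\<forall>i\<in>B. x $ i = s T i)" for T
    by (rule hyperplane0_sign_extension[OF \<open>a \<noteq> 0\<close> part le]) (simp add: s_def)
  then obtain f where f: "\<And>T. f T \<in> hyperplane0 a" "\<And>T i. \<bar>f T $ i\<bar> \<le> 1"
      "\<And>T i. i \<in> B \<Longrightarrow> f T $ i = s T i"
    by metis
  have dist: "infnorm (f T - f U) = 2" if TU: "T \<subseteq> B" "U \<subseteq> B" "T \<noteq> U" for T U
  proof -
    \<comment> \<open>At an index of the symmetric difference the signs are opposite, so the bound 2
      is attained there.\<close>
    obtain j where "j \<in> B" "j \<in> T \<longleftrightarrow> j \<notin> U" using TU by blast
    then have "\<bar>(f T - f U) $ j\<bar> = 2" by (auto simp: f(3) s_def)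
    moreover have "\<bar>(f T - f U) $ i\<bar> \<le> 2" for i
      using f(2)[of T i] f(2)[of U i] by simp
    ultimately show ?thesis by (intro infnorm_eqI)
  qed
  \<comment> \<open>Different subsets have images at distance 2, not 0, so all the points are
    distinct and can be counted by \<open>Pow B\<close>.\<close>
  have "inj_on f (Pow B)"
  proof (rule inj_onI, rule ccontr)
    fix T U assume "T \<in> Pow B" "U \<in> Pow B" "f T = f U" "T \<noteq> U"
    then show False using dist[of T U] by (simp add: infnorm_0)
  qed
  then have "card (f ` Pow B) = 2 ^ (CARD('n) - k)"
    by (simp add: card_image card_Pow card_B)
  moreover have "equilateral infnorm (f ` Pow B)"
    unfolding equilateral_def using dist by (intro exI[of _ 2]) auto
  then have "enat (card (f ` Pow B)) \<le> equilateral_dim infnorm (hyperplane0 a)"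
    using f(1) by (intro card_le_equilateral_dim) auto
  \<comment> \<open>The power in the goal is taken in \<open>enat\<close>, whereas the cardinality
    is a cast natural number.\<close>
  moreover have "enat (2 ^ m) = 2 ^ m" for m
    by (metis of_nat_eq_enat of_nat_numeral of_nat_power)
  ultimately show ?thesis by simp
qed

end
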